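(* Let $p,q,s$ be integers with $p\ge 3$, $q\ge 1$, $\gcd(p,q)=1$, and $s>0$. Then the Jones polynomial of the twisted torus link $T((p,q),(2,s))$ is not trivial, i.e. it is not equal to $1$.
   Context: The twisted torus link $T((p,q),(2,s))$ is the closure of the braid $(\sigma_1\sigma_2\cdots\sigma_{p-1})^q\sigma_1^{s}$ on $p$ strands, where $\sigma_i$ are the standard braid generators and all strands are oriented in parallel. The Jones polynomial is normalized so that the unknot has Jones polynomial $1$. *)

theory Defs
  imports Main "HOL-Library.Poly_Mapping"
begin

text \<open>
  Oriented link diagrams are encoded combinatorially, as planar diagram codes with additional path
  segments. A crossing is rotated so that both of its strands point upwards; its four ends are
  then listed as bottom left, bottom right (incoming), top left, top right (outgoing). It is
  positive iff the over-strand runs from bottom left to top right. An arc joins two points of the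
  diagram without passing a crossing. Only codes that come from actual diagrams are meaningful.
\<close>

datatype 'a crossing =
  Crossing (positive: bool) (bot_left: 'a) (bot_right: 'a) (top_left: 'a) (top_right: 'a)

record 'a link_diagram =
  points :: "'a set"
  arcs :: "('a \<times> 'a) set"
  crossings :: "'a crossing list"

definition vertical_smoothing :: "'a crossing \<Rightarrow> ('a \<times> 'a) set" where
  "vertical_smoothing c = {(bot_left c, top_left c), (bot_right c, top_right c)}"

definition horizontal_smoothing :: "'a crossing \<Rightarrow> ('a \<times> 'a) set" where
  "horizontal_smoothing c = {(bot_left c, bot_right c), (top_left c, top_right c)}"

text \<open>
  The A-smoothing merges the two regions swept out when the over-strand is turned
  counterclockwise onto the under-strand. At a positive crossing these are the top and the bottom
  region, at a negative crossing the left and the right one.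
\<close>

definition A_smoothing :: "'a crossing \<Rightarrow> ('a \<times> 'a) set" where
  "A_smoothing c = (if positive c then vertical_smoothing c else horizontal_smoothing c)"

definition B_smoothing :: "'a crossing \<Rightarrow> ('a \<times> 'a) set" where
  "B_smoothing c = (if positive c then horizontal_smoothing c else vertical_smoothing c)"

text \<open>A Kauffman state is given by the set \<open>S\<close> of (indices of) the crossings that are A-smoothed.\<close>

definition state_arcs :: "'a link_diagram \<Rightarrow> nat set \<Rightarrow> ('a \<times> 'a) set" where
  "state_arcs D S = arcs D \<union>
     (\<Union>i<length (crossings D).
        if i \<in> S then A_smoothing (crossings D ! i) else B_smoothing (crossings D ! i))"

definition num_loops :: "'a link_diagram \<Rightarrow> nat set \<Rightarrow> nat" where
  "num_loops D S = card (points D // (state_arcs D S \<union> (state_arcs D S)\<inverse>)\<^sup>*)"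

text \<open>
  The element \<open>single k c\<close> of this ring stands for the Laurent monomial \<open>c t\<^bsup>k/4\<^esup>\<close>. Quarter powers
  are needed for the bracket; the Jones polynomial itself only involves powers of \<open>t\<^bsup>1/2\<^esup>\<close>.
\<close>

type_synonym laurent = "int \<Rightarrow>\<^sub>0 int"

text \<open>The power \<open>A\<^sup>k\<close> of the bracket variable, where \<open>A = t\<^bsup>-1/4\<^esup>\<close>.\<close>

definition A_pow :: "int \<Rightarrow> laurent" where
  "A_pow k = Poly_Mapping.single (- k) 1"

definition loop_value :: laurent where
  "loop_value = - A_pow 2 - A_pow (- 2)"

definition kauffman_bracket :: "'a link_diagram \<Rightarrow> laurent" where
  "kauffman_bracket D = (let n = length (crossings D) in
     \<Sum>S \<in> Pow {..<n}.
       A_pow (int (card S) - int (card ({..<n} - S))) * loop_value ^ (num_loops D S - 1))"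

definition writhe :: "'a link_diagram \<Rightarrow> int" where
  "writhe D = (\<Sum>c\<leftarrow>crossings D. if positive c then 1 else - 1)"

text \<open>The first factor is \<open>(-A\<^sup>3)\<^bsup>-w\<^esup>\<close>, where \<open>w\<close> is the writhe.\<close>

definition jones_polynomial :: "'a link_diagram \<Rightarrow> laurent" where
  "jones_polynomial D =
     (if even (writhe D) then 1 else - 1) * A_pow (- 3 * writhe D) * kauffman_bracket D"

text \<open>On \<open>p\<close> strands, the admissible indices in a braid word are \<open>1, \<dots>, p - 1\<close>.\<close>

datatype braid_letter = Sigma (index: nat) | Sigma_inv (index: nat)

fun letter_inverse :: "braid_letter \<Rightarrow> braid_letter" where
  "letter_inverse (Sigma i) = Sigma_inv i"
| "letter_inverse (Sigma_inv i) = Sigma i"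

definition braid_power :: "braid_letter list \<Rightarrow> int \<Rightarrow> braid_letter list" where
  "braid_power w k =
     (if k \<ge> 0 then concat (replicate (nat k) w)
      else concat (replicate (nat (- k)) (rev (map letter_inverse w))))"

text \<open>
  The word is read from bottom to top, with all strands oriented upwards. The point \<open>(k, j)\<close> is the
  \<open>j\<close>-th position from the left at height \<open>k\<close>; the \<open>k\<close>-th letter (from 0) lies between the heights
  \<open>k\<close> and \<open>k + 1\<close>. A letter \<open>Sigma i\<close> is a positive crossing.
\<close>

definition braid_closure :: "nat \<Rightarrow> braid_letter list \<Rightarrow> (nat \<times> nat) link_diagram" where
  "braid_closure p w =
     \<lparr>points = {0..length w} \<times> {1..p},
      arcs = {((k, j), (Suc k, j)) | k j.
                k < length w \<and> j \<in> {1..p} \<and> j \<noteq> index (w ! k) \<and> j \<noteq> Suc (index (w ! k))}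
           \<union> {((length w, j), (0, j)) | j. j \<in> {1..p}},
      crossings = map (\<lambda>k. let i = index (w ! k) in
          Crossing (is_Sigma (w ! k)) (k, i) (k, Suc i) (Suc k, i) (Suc k, Suc i))
        [0..<length w]\<rparr>"

definition twisted_torus_braid :: "nat \<Rightarrow> int \<Rightarrow> int \<Rightarrow> braid_letter list" where
  "twisted_torus_braid p q s = braid_power (map Sigma [1..<p]) q @ braid_power [Sigma 1] s"

definition twisted_torus_link :: "nat \<Rightarrow> int \<Rightarrow> int \<Rightarrow> (nat \<times> nat) link_diagram" where
  "twisted_torus_link p q s = braid_closure p (twisted_torus_braid p q s)"

lemma jones_polynomial_unknot: "jones_polynomial (braid_closure 1 []) = 1"
proof -
  have arcs: "state_arcs (braid_closure 1 []) {} = {((0, 1), (0, 1))}"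
    by (auto simp: state_arcs_def braid_closure_def)
  have "num_loops (braid_closure 1 []) {} = 1"
    unfolding num_loops_def arcs by (simp add: braid_closure_def quotient_def)
  then show ?thesis
    by (simp add: jones_polynomial_def kauffman_bracket_def writhe_def A_pow_def
        braid_closure_def flip: single_one)
qed

end

theory Submission
  imports Defs
begin

text \<open>
  The braid is positive, and the Jones polynomial of a positive braid closure with more crossings
  than are needed to connect its strands is divisible by a positive power of \<open>t\<close>, so that its
  constant term vanishes. In detail, let a positive braid on \<open>p\<close> strands have \<open>c\<close> crossings.

  The A-smoothing of a positive crossing is vertical. So, in a Kauffman state with \<open>b\<close> crossings
  that are B-smoothed, one can descend from any point along the strands, until one reaches either
  the bottom level or the upper arc of a B-smoothed crossing. Hence the state has at most \<open>p + b\<close>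
  loops (lemma \<open>num_loops_positive_braid\<close>).

  The state contributes \<open>A\<^bsup>c-2b\<^esup>\<close> times a power of the loop value with exponent at most \<open>p + b - 1\<close>.
  Its degree in \<open>A\<close> is therefore at most \<open>(c - 2b) + 2(p + b - 1) = c + 2(p - 1)\<close>: each B-smoothing
  gains in loops no more than it loses in powers of \<open>A\<close>. The writhe is \<open>c\<close>, and the factor
  \<open>(-A\<^sup>3)\<^bsup>-c\<^esup>\<close> brings the bound down to \<open>-2(c - p + 1)\<close>; in other words, only powers of \<open>t\<close> with
  exponent at least \<open>(c - p + 1)/2\<close> occur (lemma \<open>jones_polynomial_positive_braid\<close>). For the twisted
  torus link, \<open>c - p + 1 = (p - 1)(q - 1) + s\<close> is positive.
\<close>

section \<open>Lower bounds for the exponents of Laurent polynomials\<close>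

definition order_ge :: "int \<Rightarrow> laurent \<Rightarrow> bool" where
  "order_ge m f \<longleftrightarrow> (\<forall>k \<in> Poly_Mapping.keys f. m \<le> k)"

lemma order_ge_mono: "order_ge m f \<Longrightarrow> m' \<le> m \<Longrightarrow> order_ge m' f"
  by (force simp: order_ge_def)

lemma order_ge_one: "order_ge 0 1"
  by (simp add: order_ge_def)

lemma order_ge_A_pow: "order_ge (- k) (A_pow k)"
  by (simp add: order_ge_def A_pow_def)

lemma order_ge_uminus: "order_ge m f \<Longrightarrow> order_ge m (- f)"
  by (simp add: order_ge_def)

lemma order_ge_add: "order_ge m f \<Longrightarrow> order_ge m g \<Longrightarrow> order_ge m (f + g)"
  using Poly_Mapping.keys_add[of f g] by (auto simp: order_ge_def)

lemma order_ge_diff: "order_ge m f \<Longrightarrow> order_ge m g \<Longrightarrow> order_ge m (f - g)"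
  using order_ge_add[of m f "- g"] order_ge_uminus[of m g] by simp

lemma order_ge_sum: "(\<And>x. x \<in> X \<Longrightarrow> order_ge m (f x)) \<Longrightarrow> order_ge m (sum f X)"
proof (induction X rule: infinite_finite_induct)
  case (insert x X)
  then show ?case by (simp add: order_ge_add)
qed (simp_all add: order_ge_def)

lemma order_ge_mult: "order_ge m f \<Longrightarrow> order_ge n g \<Longrightarrow> order_ge (m + n) (f * g)"
  using keys_mult[of f g] by (fastforce simp: order_ge_def)

lemma order_ge_power: "order_ge m f \<Longrightarrow> order_ge (int n * m) (f ^ n)"
  by (induction n) (auto simp: distrib_right intro: order_ge_one order_ge_mult)

lemma order_ge_loop_value: "order_ge (- 2) loop_value"
  unfolding loop_value_def
  by (intro order_ge_diff order_ge_uminus)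
    (auto intro: order_ge_mono[OF order_ge_A_pow])

lemma order_ge_positive_imp_neq_one: "order_ge m f \<Longrightarrow> m > 0 \<Longrightarrow> f \<noteq> 1"
  by (auto simp: order_ge_def)

section \<open>Kauffman states of positive braid closures\<close>

abbreviation same_loop :: "'a link_diagram \<Rightarrow> nat set \<Rightarrow> ('a \<times> 'a) set" where
  "same_loop D S \<equiv> (state_arcs D S \<union> (state_arcs D S)\<inverse>)\<^sup>*"

lemma equiv_same_loop: "equiv UNIV (same_loop D S)"
  by (simp add: equiv_def refl_rtrancl sym_rtrancl sym_Un_converse trans_rtrancl)

lemma num_loops_le_card:
  assumes "finite X" and "\<And>y. y \<in> points D \<Longrightarrow> \<exists>x \<in> X. (x, y) \<in> same_loop D S"
  shows "num_loops D S \<le> card X"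
proof -
  have "points D // same_loop D S \<subseteq> (\<lambda>x. same_loop D S `` {x}) ` X"
  proof
    fix C assume "C \<in> points D // same_loop D S"
    then obtain y where y: "y \<in> points D" "C = same_loop D S `` {y}"
      by (auto elim: quotientE)
    obtain x where "x \<in> X" "(x, y) \<in> same_loop D S"
      using assms(2)[OF y(1)] by blast
    moreover have "same_loop D S `` {x} = same_loop D S `` {y}"
      using equiv_class_eq[OF equiv_same_loop \<open>(x, y) \<in> same_loop D S\<close>] .
    ultimately show "C \<in> (\<lambda>x. same_loop D S `` {x}) ` X"
      using y(2) by blast
  qed
  then show ?thesis
    unfolding num_loops_def using assms(1) by (rule surj_card_le[rotated])
qed

lemma smoothing_in_state_arcs:
  assumes "k < length (crossings D)"
  shows "k \<in> S \<Longrightarrow> A_smoothing (crossings D ! k) \<subseteq> state_arcs D S"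
    and "k \<notin> S \<Longrightarrow> B_smoothing (crossings D ! k) \<subseteq> state_arcs D S"
  using assms by (force simp: state_arcs_def)+

text \<open>
  Going down by one level is possible along a vertical arc, whether it belongs to no crossing or
  to an A-smoothed one. Otherwise the point is an end of the upper arc of a B-smoothed crossing,
  and that arc is represented by its left end.
\<close>

lemma descend_positive_braid:
  assumes "list_all is_Sigma w" and "k < length w" and "j \<in> {1..p}"
  defines "D \<equiv> braid_closure p w"
  shows "((k, j), (Suc k, j)) \<in> same_loop D S \<or>
    k \<notin> S \<and> ((Suc k, index (w ! k)), (Suc k, j)) \<in> same_loop D S"
proof (cases "j = index (w ! k) \<or> j = Suc (index (w ! k))")
  case False
  then have "((k, j), (Suc k, j)) \<in> state_arcs D S"
    using assms by (simp add: state_arcs_def braid_closure_def)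
  then show ?thesis by blast
next
  case True
  define i where "i = index (w ! k)"
  have len: "k < length (crossings D)"
    using assms by (simp add: braid_closure_def)
  have "is_Sigma (w ! k)"
    using assms by (simp add: list_all_length)
  then have crossing: "crossings D ! k = Crossing True (k, i) (k, Suc i) (Suc k, i) (Suc k, Suc i)"
    using assms by (simp add: braid_closure_def i_def Let_def)
  show ?thesis
  proof (cases "k \<in> S")
    case S: True
    then have "((k, j), (Suc k, j)) \<in> state_arcs D S"
      using smoothing_in_state_arcs(1)[OF len S] True
      by (auto simp: crossing A_smoothing_def vertical_smoothing_def i_def)
    then show ?thesis by blast
  next
    case S: False
    then have "((Suc k, i), (Suc k, Suc i)) \<in> same_loop D S"
      using smoothing_in_state_arcs(2)[OF len S]
      by (auto simp: crossing B_smoothing_def horizontal_smoothing_def)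
    then show ?thesis
      using True S by (auto simp: i_def)
  qed
qed

lemma num_loops_positive_braid:
  assumes w: "list_all is_Sigma w"
  shows "num_loops (braid_closure p w) S \<le> p + card ({..<length w} - S)"
proof -
  let ?D = "braid_closure p w"
  define X where "X = {0} \<times> {1..p} \<union> (\<lambda>k. (Suc k, index (w ! k))) ` ({..<length w} - S)"
  have reach: "\<exists>x \<in> X. (x, (h, j)) \<in> same_loop ?D S" if "h \<le> length w" "j \<in> {1..p}" for h j
    using that
  proof (induction h)
    case 0
    then have "(0, j) \<in> X" by (simp add: X_def)
    then show ?case by blast
  next
    case (Suc k)
    then obtain x where x: "x \<in> X" "(x, (k, j)) \<in> same_loop ?D S" by auto
    from Suc.prems have k: "k < length w" by simp
    from descend_positive_braid[OF w k Suc.prems(2)] show ?case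
    proof
      assume "((k, j), (Suc k, j)) \<in> same_loop ?D S"
      with x show ?thesis by (meson rtrancl_trans)
    next
      assume up: "k \<notin> S \<and> ((Suc k, index (w ! k)), (Suc k, j)) \<in> same_loop ?D S"
      then have "(Suc k, index (w ! k)) \<in> X"
        using k by (auto simp: X_def)
      with up show ?thesis by blast
    qed
  qed
  have "num_loops ?D S \<le> card X"
    using reach by (intro num_loops_le_card) (auto simp: X_def braid_closure_def)
  also have "\<dots> \<le> card ({0::nat} \<times> {1..p}) +
      card ((\<lambda>k. (Suc k, index (w ! k))) ` ({..<length w} - S))"
    unfolding X_def by (rule card_Un_le)
  also have "\<dots> \<le> p + card ({..<length w} - S)"
    by (simp add: card_cartesian_product card_image_le)
  finally show ?thesis .
qed

section \<open>The Jones polynomial of positive braid closures\<close>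

lemma kauffman_bracket_positive_braid:
  assumes "list_all is_Sigma w" and "p \<ge> 1"
  shows "order_ge (2 - int (length w) - 2 * int p) (kauffman_bracket (braid_closure p w))"
proof -
  let ?D = "braid_closure p w" and ?c = "length w"
  have len: "length (crossings ?D) = ?c"
    by (simp add: braid_closure_def)
  have "order_ge (2 - int ?c - 2 * int p)
      (A_pow (int (card S) - int (card ({..<?c} - S))) * loop_value ^ (num_loops ?D S - 1))"
    if "S \<subseteq> {..<?c}" for S
  proof -
    let ?a = "card S" and ?b = "card ({..<?c} - S)" and ?l = "num_loops ?D S - 1"
    have "?a + ?b = ?c"
      using card_Diff_subset[of S "{..<?c}"] card_mono[of "{..<?c}" S] that
      by (simp add: finite_subset[OF that])
    moreover have "?l \<le> p + ?b - 1"
      using num_loops_positive_braid[OF assms(1), of p S] by simp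
    \<comment> \<open>Since \<open>p \<ge> 1\<close>, the truncated difference \<open>p + b - 1\<close> is the actual one.\<close>
    ultimately have "2 - int ?c - 2 * int p \<le> - (int ?a - int ?b) + int ?l * (- 2)"
      using assms(2) by linarith
    then show ?thesis
      by (rule order_ge_mono[OF order_ge_mult[OF order_ge_A_pow
              order_ge_power[OF order_ge_loop_value]]])
  qed
  then show ?thesis
    unfolding kauffman_bracket_def len Let_def by (intro order_ge_sum) auto
qed

lemma writhe_positive_braid:
  assumes "list_all is_Sigma w"
  shows "writhe (braid_closure p w) = int (length w)"
proof -
  have "writhe (braid_closure p w) = (\<Sum>k\<leftarrow>[0..<length w]. if is_Sigma (w ! k) then 1 else - 1)"
    by (simp add: writhe_def braid_closure_def Let_def comp_def)
  also have "\<dots> = (\<Sum>k\<leftarrow>[0..<length w]. 1)"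
    using assms by (intro arg_cong[of _ _ sum_list] map_cong) (auto simp: list_all_length)
  finally show ?thesis
    by (simp add: sum_list_triv)
qed

text \<open>
  Exponents count quarter powers of \<open>t\<close>. For a knot, \<open>(c - p + 1)/2\<close> is the genus of the surface
  that Seifert's algorithm yields.
\<close>

lemma jones_polynomial_positive_braid:
  assumes "list_all is_Sigma w" and "p \<ge> 1"
  shows "order_ge (2 * (int (length w) - int p + 1)) (jones_polynomial (braid_closure p w))"
proof -
  let ?c = "int (length w)"
  have "order_ge 0 (if even ?c then 1 else - 1 :: laurent)"
    by (simp add: order_ge_one order_ge_uminus)
  from order_ge_mult[OF order_ge_mult[OF this order_ge_A_pow[of "- 3 * ?c"]]
      kauffman_bracket_positive_braid[OF assms]]
  show ?thesis
    unfolding jones_polynomial_def writhe_positive_braid[OF assms(1)]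
    by (rule order_ge_mono) simp
qed

section \<open>Twisted torus links\<close>

lemma length_braid_power: "k \<ge> 0 \<Longrightarrow> int (length (braid_power w k)) = k * int (length w)"
  by (simp add: braid_power_def length_concat sum_list_replicate)

lemma is_Sigma_braid_power: "k \<ge> 0 \<Longrightarrow> list_all is_Sigma w \<Longrightarrow> list_all is_Sigma (braid_power w k)"
  by (auto simp: braid_power_def list_all_iff)

theorem proposition4p6:
  fixes p :: nat and q s :: int
  assumes "p \<ge> 3" and "q \<ge> 1" and "gcd (int p) q = 1" and "s > 0"
  shows "jones_polynomial (twisted_torus_link p q s) \<noteq> 1"
proof -
  let ?w = "twisted_torus_braid p q s"
  have positive: "list_all is_Sigma ?w"
    using assms by (simp add: twisted_torus_braid_def is_Sigma_braid_power list_all_iff[of _ "map _ _"])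
  have "int (length ?w) = q * (int p - 1) + s"
    using assms by (simp add: twisted_torus_braid_def length_braid_power of_nat_diff)
  moreover have "int p - 1 \<le> q * (int p - 1)"
    using mult_right_mono[of 1 q "int p - 1"] assms by simp
  ultimately have "2 * (int (length ?w) - int p + 1) > 0"
    using assms(4) by simp
  moreover have "order_ge (2 * (int (length ?w) - int p + 1))
      (jones_polynomial (twisted_torus_link p q s))"
    unfolding twisted_torus_link_def
    using jones_polynomial_positive_braid[OF positive] assms(1) by simp
  ultimately show ?thesis
    by (rule order_ge_positive_imp_neq_one[rotated])
qed

end
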